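(* Let $A\in\mathbb{R}^{m\times n}$ have full row rank, $b\in\mathbb{R}^m$, $c\in\mathbb{R}^n$, and $0<\gamma<1$. Let $z_0=(x_0,y_0,s_0)$ be a strictly primal-dual feasible point, i.e. $Ax_0=b$, $A^Ty_0+s_0=c$, $(x_0,s_0)>0$, and let $z_k=(x_k,y_k,s_k)$, $k=0,1,2,\dots$, be the sequence generated from $z_0$ by the PFMTRLP iteration (defined in the context). Suppose that $z_k\in\mathbb{N}_{-\infty}(\gamma)$ for all $k=0,1,2,\dots$. Then $$\lim_{k\to\infty}\mu_k=0,\qquad\text{where } \mu_k=\frac{x_k^Ts_k}{n}.$$
   Context: The linear program is $\min_{x\in\mathbb{R}^n} c^Tx$ subject to $Ax=b$, $x\ge 0$. Vector inequalities are componentwise, $\|\cdot\|$ is the Euclidean norm, $e=(1,\dots,1)^T\in\mathbb{R}^n$, and for $x,s\in\mathbb{R}^n$, $X=\mathrm{diag}(x)$, $S=\mathrm{diag}(s)$ (similarly $X_k,S_k$). Strictly feasible set: $\mathbb{F}^0=\{(x,y,s)\in\mathbb{R}^n\times\mathbb{R}^m\times\mathbb{R}^n : Ax=b,\ A^Ty+s=c,\ (x,s)>0\}$. One-sided neighborhood: $\mathbb{N}_{-\infty}(\gamma)=\{(x,y,s)\in\mathbb{F}^0 : XSe\ge\gamma\mu e\}$ with $\mu=x^Ts/n$. For $\nu\in\mathbb{R}$ and $z=(x,y,s)$ let $$F_\nu(z)=\begin{bmatrix}Ax-b\\ A^Ty+s-c\\ XSe-\nu e\end{bmatrix},\qquad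 J(z)=\begin{bmatrix}A&0&0\\0&A^T&I\\S&0&X\end{bmatrix}.$$ PFMTRLP iteration (run as an infinite iteration, without stopping tests, from a given $z_0$). Constants: $\eta_a=10^{-6}$, $\eta_1=0.25$, $\eta_2=0.75$, $\Delta t_0=0.9$. Given $z_k=(x_k,y_k,s_k)$ with $(x_k,s_k)>0$ and $\Delta t_k>0$: 1. Set $\mu_k=(\|Ax_k-b\|_1+\|A^Ty_k+s_k-c\|_1+x_k^Ts_k)/n$ (which equals $x_k^Ts_k/n$ when $z_k$ is feasible) and $\sigma_k=\min(0.05,\mu_k)$. 2. Let $d_k=(\Delta x_k,\Delta y_k,\Delta s_k)$ be the solution of $J(z_k)d_k=-F_{\sigma_k\mu_k}(z_k)$. 3. Set $\alpha_k=\Delta t_k/(1+\Delta t_k)$ and the trial point $\hat z_k=(\hat x_k,\hat y_k,\hat s_k)=z_k+\alpha_k d_k$. 4. Compute $$\rho_k=\frac{\|F_{\sigma_k\mu_k}(z_k)\|-\|F_{\sigma_k\mu_k}(\hat z_k)\|}{\|F_{\sigma_k\mu_k}(z_k)\|-\|F_{\sigma_k\mu_k}(z_k)+\alpha_kJ(z_k)d_k\|}.$$ 5. Set $\Delta t_{k+1}=2\Delta t_k$ if $|1-\rho_k|\le\eta_1$ and $(\hat x_k,\hat s_k)>0$; $\Delta t_{k+1}=\Delta t_k$ if $\eta_1<|1-\rho_k|\le\eta_2$ and $(\hat x_k,\hat s_k)>0$; and $\Delta t_{k+1}=\tfrac12\Delta t_k$ otherwise. 6. If $\rho_k\ge\eta_a$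 and $(\hat x_k,\hat s_k)>0$, set $z_{k+1}=\hat z_k$; otherwise set $z_{k+1}=z_k$. *)

theory Defs
  imports "HOL-Analysis.Analysis"
begin

text \<open>
  A primal-dual point is a triple \<open>(x, y, s)\<close>.  The norm of the library on nested products is the
  Euclidean norm of the concatenated vector, so \<open>norm\<close> below is always the Euclidean norm.
\<close>

type_synonym ('n, 'm) pd_point = "(real^'n) \<times> (real^'m) \<times> (real^'n)"
type_synonym ('n, 'm) pd_residual = "(real^'m) \<times> (real^'n) \<times> (real^'n)"

definition diag :: "real^'n \<Rightarrow> real^'n^'n" where
  "diag x = (\<chi> i j. if i = j then x $ i else 0)"

definition norm1 :: "real^'n \<Rightarrow> real" where
  "norm1 v = (\<Sum>i\<in>UNIV. \<bar>v $ i\<bar>)"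

text \<open>
  The library order \<open><\<close> on \<open>real^'n\<close> means ``\<open>\<le>\<close> and not \<open>\<ge>\<close>''; the strict inequality needed here
  is the componentwise one.
\<close>

definition vec_pos :: "real^'n \<Rightarrow> bool" where
  "vec_pos v \<longleftrightarrow> (\<forall>i. 0 < v $ i)"

definition xs_pos :: "('n::finite, 'm::finite) pd_point \<Rightarrow> bool" where
  "xs_pos = (\<lambda>(x, y, s). vec_pos x \<and> vec_pos s)"

definition strictly_feasible ::
  "real^'n^'m \<Rightarrow> real^'m \<Rightarrow> real^'n \<Rightarrow> ('n, 'm) pd_point set" where
  "strictly_feasible A b c =
     {(x, y, s). A *v x = b \<and> transpose A *v y + s = c \<and> vec_pos x \<and> vec_pos s}"

text \<open>The vector \<open>1 :: real^'n\<close> is \<open>e\<close>, and \<open>\<le>\<close> on \<open>real^'n\<close> is componentwise.\<close>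

definition one_sided_nbhd ::
  "real^'n^'m \<Rightarrow> real^'m \<Rightarrow> real^'n \<Rightarrow> real \<Rightarrow> ('n, 'm) pd_point set" where
  "one_sided_nbhd A b c \<gamma> =
     {(x, y, s). (x, y, s) \<in> strictly_feasible A b c \<and>
        (let \<mu> = (x \<bullet> s) / real CARD('n)
         in (\<gamma> * \<mu>) *\<^sub>R 1 \<le> (diag x ** diag s) *v 1)}"

definition F_map ::
  "real^'n^'m \<Rightarrow> real^'m \<Rightarrow> real^'n \<Rightarrow> real \<Rightarrow> ('n, 'm) pd_point \<Rightarrow> ('n, 'm) pd_residual" where
  "F_map A b c \<nu> = (\<lambda>(x, y, s).
     (A *v x - b, transpose A *v y + s - c, (diag x ** diag s) *v 1 - \<nu> *\<^sub>R 1))"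

text \<open>
  The block matrix \<open>J(z)\<close> is rendered through its action on \<open>(\<Delta>x, \<Delta>y, \<Delta>s)\<close>, block row by block row.
\<close>

definition J_map ::
  "real^'n^'m \<Rightarrow> ('n, 'm) pd_point \<Rightarrow> ('n, 'm) pd_point \<Rightarrow> ('n, 'm) pd_residual" where
  "J_map A = (\<lambda>(x, y, s) (dx, dy, ds).
     (A *v dx, transpose A *v dy + ds, diag s *v dx + diag x *v ds))"

definition mu_alg :: "real^'n^'m \<Rightarrow> real^'m \<Rightarrow> real^'n \<Rightarrow> ('n, 'm) pd_point \<Rightarrow> real" where
  "mu_alg A b c = (\<lambda>(x, y, s).
     (norm1 (A *v x - b) + norm1 (transpose A *v y + s - c) + x \<bullet> s) / real CARD('n))"

text \<open>
  One iteration, as a relation between the current pair \<open>(z, \<Delta>t)\<close>, the Newton direction \<open>d\<close> and the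
  next pair \<open>(z', \<Delta>t')\<close>.  If \<open>A\<close> has full row rank and \<open>(x, s) > 0\<close>, then \<open>J(z)\<close> is nonsingular, so
  \<open>d\<close>, and hence the next pair, exists and is determined by \<open>(z, \<Delta>t)\<close>.
\<close>

definition pfmtrlp_step ::
  "real^'n^'m \<Rightarrow> real^'m \<Rightarrow> real^'n \<Rightarrow> ('n, 'm) pd_point \<Rightarrow> real \<Rightarrow> ('n, 'm) pd_point
     \<Rightarrow> ('n, 'm) pd_point \<Rightarrow> real \<Rightarrow> bool" where
  "pfmtrlp_step A b c z \<Delta>t d z' \<Delta>t' \<longleftrightarrow>
     (let \<eta>a = 1 / 10 ^ 6;
          \<eta>1 = 25 / 100;
          \<eta>2 = 75 / 100;
          \<mu> = mu_alg A b c z;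
          \<sigma> = min (5 / 100) \<mu>;
          F = F_map A b c (\<sigma> * \<mu>);
          \<alpha> = \<Delta>t / (1 + \<Delta>t);
          zhat = z + \<alpha> *\<^sub>R d;
          \<rho> = (norm (F z) - norm (F zhat)) /
              (norm (F z) - norm (F z + \<alpha> *\<^sub>R J_map A z d))
      in J_map A z d = - F z \<and>
         \<Delta>t' = (if \<bar>1 - \<rho>\<bar> \<le> \<eta>1 \<and> xs_pos zhat then 2 * \<Delta>t
                else if \<eta>1 < \<bar>1 - \<rho>\<bar> \<and> \<bar>1 - \<rho>\<bar> \<le> \<eta>2 \<and> xs_pos zhat then \<Delta>t
                else \<Delta>t / 2) \<and>
         z' = (if \<rho> \<ge> \<eta>a \<and> xs_pos zhat then zhat else z))"

definition pfmtrlp_sequence ::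
  "real^'n^'m \<Rightarrow> real^'m \<Rightarrow> real^'n \<Rightarrow> ('n, 'm) pd_point \<Rightarrow> (nat \<Rightarrow> ('n, 'm) pd_point) \<Rightarrow> bool" where
  "pfmtrlp_sequence A b c z0 z \<longleftrightarrow>
     (\<exists>\<Delta>t d. z 0 = z0 \<and> \<Delta>t 0 = 9 / 10 \<and>
        (\<forall>k. pfmtrlp_step A b c (z k) (\<Delta>t k) (d k) (z (Suc k)) (\<Delta>t (Suc k))))"

end

theory Submission
  imports Defs
begin

text \<open>
  At a strictly feasible point with Newton direction \<open>(\<Delta>x, \<Delta>y, \<Delta>s)\<close>, feasibility is linear and
  \<open>\<Delta>x\<close> is orthogonal to \<open>\<Delta>s\<close>, so the residual at the trial point is
  \<open>(1 - \<alpha>) (XSe - \<sigma>\<mu>e) + \<alpha>\<^sup>2 \<Delta>X\<Delta>Se\<close> and its duality measure is \<open>(1 - \<alpha> (1 - \<sigma>)) \<mu>\<close>.  In the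
  one-sided neighbourhood \<open>\<parallel>\<Delta>X\<Delta>Se\<parallel> \<le> C\<mu>\<close> while \<open>\<parallel>XSe - \<sigma>\<mu>e\<parallel> \<ge> 0.95 \<mu>\<close>, whence
  \<open>\<bar>1 - \<rho>\<bar> \<le> \<alpha> C / 0.95\<close> with \<open>C\<close> depending only on \<open>n\<close> and \<open>\<gamma>\<close>.  So a small time step is always
  doubled, the time steps stay away from zero, and since a rejection halves the time step
  infinitely many trial points are accepted.  Each of these shrinks \<open>\<mu>\<close> by a factor bounded away
  from one.
\<close>

section \<open>Componentwise formulas and the cross term of a Newton step\<close>

lemma diag_mult_vec_nth: "(diag x *v v) $ i = x $ i * v $ i"
proof -
  have "(diag x *v v) $ i = (\<Sum>j\<in>UNIV. if i = j then x $ i * v $ j else 0)"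
    unfolding diag_def matrix_vector_mult_def by (simp add: if_distrib[of "\<lambda>t. t * _"] cong: if_cong)
  then show ?thesis
    by simp
qed

lemma diag_diag_one_nth: "((diag x ** diag s) *v 1) $ i = x $ i * s $ i"
  by (simp add: matrix_vector_mul_assoc[symmetric] diag_mult_vec_nth)

lemma inner_eq_sum: "(x :: real^'n) \<bullet> s = (\<Sum>i\<in>UNIV. x $ i * s $ i)"
  by (simp add: inner_vec_def)

text \<open>The second equation puts \<open>ds\<close> = - A^T \<open>dy\<close> in the row space of
  \<open>A\<close>, while \<open>dx\<close> lies in the kernel of \<open>A\<close>.\<close>

lemma null_space_orthogonal:
  fixes A :: "real^'n^'m"
  assumes "A *v dx = 0" "transpose A *v dy + ds = 0"
  shows "dx \<bullet> ds = 0"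
proof -
  have "dx \<bullet> (transpose A *v dy) = 0"
    using assms(1) by (metis dot_lmul_matrix inner_commute inner_zero_left transpose_matrix_vector)
  moreover have "dx \<bullet> (transpose A *v dy) + dx \<bullet> ds = 0"
    using assms(2) by (metis inner_add_right inner_zero_right)
  ultimately show ?thesis
    by simp
qed

text \<open>
  With \<open>r\<^sub>i = \<sigma>\<mu> - x\<^sub>i s\<^sub>i\<close>, squaring \<open>s\<^sub>i \<Delta>x\<^sub>i + x\<^sub>i \<Delta>s\<^sub>i = r\<^sub>i\<close>, dividing by \<open>x\<^sub>i s\<^sub>i\<close> and summing
  removes the mixed terms by orthogonality.
\<close>

lemma sum_abs_cross_le:
  fixes x s dx ds :: "real^'n"
  assumes pos: "vec_pos x" "vec_pos s" and g: "0 < \<gamma>"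
    and mu: "\<mu> = (x \<bullet> s) / real CARD('n)"
    and lb: "\<And>i. \<gamma> * \<mu> \<le> x $ i * s $ i"
    and sig: "0 \<le> \<sigma>" "\<sigma> \<le> 1"
    and eqn: "\<And>i. s $ i * dx $ i + x $ i * ds $ i = \<sigma> * \<mu> - x $ i * s $ i"
    and orth: "dx \<bullet> ds = 0"
  shows "(\<Sum>i\<in>UNIV. \<bar>dx $ i * ds $ i\<bar>) \<le> real CARD('n) * (1 + 1 / \<gamma>) / 2 * \<mu>"
proof -
  have xp: "x $ i > 0" and sp: "s $ i > 0" for i
    using pos by (auto simp: vec_pos_def)
  have xs: "x \<bullet> s = real CARD('n) * \<mu>"
    by (simp add: mu)
  have "0 < x \<bullet> s"
    unfolding inner_eq_sum by (intro sum_pos) (auto simp: xp sp)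
  then have mup: "\<mu> > 0"
    by (simp add: mu)
  have pt: "2 * \<bar>dx $ i * ds $ i\<bar> \<le> \<mu> / \<gamma> + x $ i * s $ i - 2 * (dx $ i * ds $ i)" for i
  proof -
    let ?p = "x $ i * s $ i" and ?u = "s $ i * dx $ i" and ?v = "x $ i * ds $ i"
    have p: "?p > 0"
      by (simp add: xp sp)
    have uv: "?u * ?v = ?p * (dx $ i * ds $ i)"
      by simp
    have "2 * \<bar>?u * ?v\<bar> \<le> ?u\<^sup>2 + ?v\<^sup>2"
      using sum_squares_bound[of "\<bar>?u\<bar>" "\<bar>?v\<bar>"] by (simp add: abs_mult power_mult_distrib mult.assoc)
    also have "\<dots> = (?u + ?v)\<^sup>2 - 2 * (?u * ?v)"
      by (simp add: power2_eq_square algebra_simps)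
    also have "(?u + ?v)\<^sup>2 \<le> \<mu>\<^sup>2 + ?p\<^sup>2"
    proof -
      have "(\<sigma> * \<mu>)\<^sup>2 \<le> \<mu>\<^sup>2"
        using sig mup by (intro power_mono) (auto simp: mult_left_le_one_le)
      moreover have "0 \<le> \<sigma> * \<mu> * ?p"
        using sig mup p by simp
      ultimately show ?thesis
        unfolding eqn by (simp add: power2_eq_square algebra_simps)
    qed
    \<comment> \<open>Here the neighbourhood enters: \<open>lb\<close> trades one factor \<mu> for
      \<open>?p\<close>, so that \<open>?p\<close> can be cancelled from both sides.\<close>
    also have "\<mu>\<^sup>2 \<le> ?p * (\<mu> / \<gamma>)"
      using mult_right_mono[OF lb[of i], of "\<mu> / \<gamma>"] mup g by (simp add: power2_eq_square)
    finally have "?p * (2 * \<bar>dx $ i * ds $ i\<bar>) \<le> ?p * (\<mu> / \<gamma> + ?p - 2 * (dx $ i * ds $ i))"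
      unfolding uv abs_mult[of ?p] using p by (simp add: power2_eq_square algebra_simps)
    then show ?thesis
      using p by (simp only: mult_le_cancel_left_pos)
  qed
  have "2 * (\<Sum>i\<in>UNIV. \<bar>dx $ i * ds $ i\<bar>)
      \<le> (\<Sum>i\<in>UNIV. \<mu> / \<gamma> + x $ i * s $ i - 2 * (dx $ i * ds $ i))"
    unfolding sum_distrib_left by (intro sum_mono pt)
  also have "\<dots> = real CARD('n) * (\<mu> / \<gamma>) + x \<bullet> s - 2 * (dx \<bullet> ds)"
    by (simp add: sum.distrib sum_subtractf inner_eq_sum sum_distrib_left)
  also have "\<dots> = real CARD('n) * (1 + 1 / \<gamma>) * \<mu>"
    using orth xs by (simp add: algebra_simps)
  finally show ?thesis
    by simp
qed

section \<open>Residuals and positivity of trial points\<close>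

lemma sum_components_le_norm:
  fixes v :: "real^'n"
  shows "(\<Sum>i\<in>UNIV. v $ i) \<le> real CARD('n) * norm v"
proof -
  have "(\<Sum>i\<in>UNIV. v $ i) \<le> (\<Sum>i\<in>(UNIV::'n set). norm v)"
    by (intro sum_mono) (metis abs_le_D1 component_le_norm_cart)
  then show ?thesis
    by simp
qed

lemma F_map_feasible:
  assumes "A *v x = b" "transpose A *v y + s = c"
  shows "F_map A b c \<nu> (x, y, s) = (0, 0, \<chi> i. x $ i * s $ i - \<nu>)"
  using assms by (simp add: F_map_def vec_eq_iff diag_diag_one_nth)

text \<open>A positive product leaves only the case of two negative factors. The Newton equation
  excludes it, because the sum of the new values weighted by \<open>s\<close> and \<open>x\<close>
  is (2 - \<alpha>) x s + \<alpha> \<nu>, which is nonnegative. Positivity thus follows from the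
  product at the endpoint alone, without a continuity argument along the step.\<close>

lemma pos_trial_component:
  fixes x s :: real
  assumes "x > 0" "s > 0" "0 \<le> \<alpha>" "\<alpha> < 1" "\<nu> \<ge> 0"
    and "s * dx + x * ds = \<nu> - x * s" "(x + \<alpha> * dx) * (s + \<alpha> * ds) > 0"
  shows "x + \<alpha> * dx > 0 \<and> s + \<alpha> * ds > 0"
proof (rule ccontr)
  assume "\<not> ?thesis"
  then have "x + \<alpha> * dx < 0" "s + \<alpha> * ds < 0"
    using assms(7) by (auto simp: zero_less_mult_iff)
  then have "s * (x + \<alpha> * dx) + x * (s + \<alpha> * ds) < 0"
    using assms(1,2) by (simp add: add_neg_neg mult_pos_neg)
  moreover have "s * (x + \<alpha> * dx) + x * (s + \<alpha> * ds) = 2 * (x * s) + \<alpha> * (s * dx + x * ds)"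
    by (simp add: algebra_simps)
  moreover have "\<dots> = (2 - \<alpha>) * (x * s) + \<alpha> * \<nu>"
    unfolding assms(6) by (simp add: algebra_simps)
  moreover have "\<dots> \<ge> 0"
    using assms by simp
  ultimately show False
    by linarith
qed

section \<open>One iteration from a point of the neighbourhood\<close>

text \<open>
  The bound \<open>\<gamma> / (8 C)\<close>, with \<open>C = n (1 + 1 / \<gamma>) / 2\<close> from the cross term estimate, makes both
  \<open>\<alpha> C / 0.95 \<le> 1 / 4\<close> and \<open>\<alpha>\<^sup>2 C < (1 - \<alpha>) \<gamma>\<close>.
\<close>

lemma pfmtrlp_step_nbhd:
  fixes A :: "real^'n^'m" and x s x' s' :: "real^'n" and y y' :: "real^'m"
  assumes g: "0 < \<gamma>" "\<gamma> < 1" and t: "t > 0"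
    and nb: "(x, y, s) \<in> one_sided_nbhd A b c \<gamma>"
    and step: "pfmtrlp_step A b c (x, y, s) t d (x', y', s') t'"
  defines "C \<equiv> real CARD('n) * (1 + 1 / \<gamma>) / 2"
    and "\<mu> \<equiv> x \<bullet> s / real CARD('n)" and "\<mu>' \<equiv> x' \<bullet> s' / real CARD('n)"
  shows "t \<le> \<gamma> / (8 * C) \<Longrightarrow> t' = 2 * t" and "t / 2 \<le> t'"
    and "\<mu>' = \<mu> \<and> t' = t / 2 \<or> \<mu>' \<le> (1 - 95 / 100 * (t / (1 + t))) * \<mu>"
proof -
  \<comment> \<open>This later turns a bound on \<alpha> * C into one on \<alpha> itself.\<close>
  have C1: "C \<ge> 1"
  proof -
    have "1 * 2 \<le> real CARD('n) * (1 + 1 / \<gamma>)"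
      using g by (intro mult_mono) (auto simp: Suc_le_eq)
    then show ?thesis
      by (simp add: C_def)
  qed
  obtain dx dy ds where d: "d = (dx, dy, ds)"
    by (cases d) auto
  have Ax: "A *v x = b" and Ay: "transpose A *v y + s = c" and pos: "vec_pos x" "vec_pos s"
    and lb': "(\<gamma> * \<mu>) *\<^sub>R 1 \<le> (diag x ** diag s) *v 1"
    using nb by (auto simp: one_sided_nbhd_def strictly_feasible_def \<mu>_def Let_def)
  have lb: "\<gamma> * \<mu> \<le> x $ i * s $ i" for i
    using lb' by (auto simp: less_eq_vec_def diag_diag_one_nth)
  have xp: "x $ i > 0" and sp: "s $ i > 0" for i
    using pos by (auto simp: vec_pos_def)
  have xs: "x \<bullet> s = real CARD('n) * \<mu>"
    by (simp add: \<mu>_def)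
  have "0 < x \<bullet> s"
    unfolding inner_eq_sum by (intro sum_pos) (auto simp: xp sp)
  then have mup: "\<mu> > 0"
    by (simp add: \<mu>_def)
  have mu: "mu_alg A b c (x, y, s) = \<mu>"
  proof -
    have "mu_alg A b c (x, y, s)
        = (norm1 (A *v x - b) + norm1 (transpose A *v y + s - c) + x \<bullet> s) / real CARD('n)"
      by (simp only: mu_alg_def prod.case)
    then show ?thesis
      by (simp only: Ax Ay \<mu>_def) (simp add: norm1_def)
  qed
  define \<sigma> where "\<sigma> = min (5 / 100) \<mu>"
  have sig: "0 \<le> \<sigma>" "\<sigma> \<le> 5 / 100" "\<sigma> \<le> 1"
    using mup by (auto simp: \<sigma>_def)
  define \<alpha> where "\<alpha> = t / (1 + t)"
  have a: "0 < \<alpha>" "\<alpha> < 1" "\<alpha> \<le> t"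
    using t by (auto simp: \<alpha>_def field_simps)
  define F where "F = F_map A b c (\<sigma> * \<mu>)"
  define zhat where "zhat = (x, y, s) + \<alpha> *\<^sub>R d"
  define \<rho> where "\<rho> = (norm (F (x, y, s)) - norm (F zhat)) /
    (norm (F (x, y, s)) - norm (F (x, y, s) + \<alpha> *\<^sub>R J_map A (x, y, s) d))"
  have J: "J_map A (x, y, s) d = - F (x, y, s)"
    and t': "t' = (if \<bar>1 - \<rho>\<bar> \<le> 25 / 100 \<and> xs_pos zhat then 2 * t
                else if 25 / 100 < \<bar>1 - \<rho>\<bar> \<and> \<bar>1 - \<rho>\<bar> \<le> 75 / 100 \<and> xs_pos zhat then t
                else t / 2)"
    and z': "(x', y', s') = (if \<rho> \<ge> 1 / 10 ^ 6 \<and> xs_pos zhat then zhat else (x, y, s))"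
    using step unfolding pfmtrlp_step_def Let_def mu \<sigma>_def[symmetric] F_def[symmetric]
      \<alpha>_def[symmetric] zhat_def[symmetric] \<rho>_def[symmetric] by blast+
  define r :: "real^'n" where "r = (\<chi> i. x $ i * s $ i - \<sigma> * \<mu>)"
  define w :: "real^'n" where "w = (\<chi> i. dx $ i * ds $ i)"
  have Fz: "F (x, y, s) = (0, 0, r)"
    unfolding F_def r_def by (rule F_map_feasible[OF Ax Ay])
  have "A *v dx = 0" "transpose A *v dy + ds = 0" and Js: "diag s *v dx + diag x *v ds = - r"
    using J unfolding Fz d by (auto simp: J_map_def)
  then have Adx: "A *v dx = 0" and Ady: "transpose A *v dy + ds = 0"
    by auto
  have eqn: "s $ i * dx $ i + x $ i * ds $ i = \<sigma> * \<mu> - x $ i * s $ i" for i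
    using arg_cong[OF Js, of "\<lambda>v. v $ i"] by (simp add: diag_mult_vec_nth r_def)
  have orth: "dx \<bullet> ds = 0"
    by (rule null_space_orthogonal[OF Adx Ady])
  have cross: "(\<Sum>i\<in>UNIV. \<bar>w $ i\<bar>) \<le> C * \<mu>"
    using sum_abs_cross_le[OF pos g(1) meta_eq_to_obj_eq[OF \<mu>_def] lb sig(1,3) eqn orth]
    by (simp add: C_def w_def)
  have normw: "norm w \<le> C * \<mu>"
    using norm_le_l1_cart[of w] cross by linarith
  have compw: "\<bar>w $ i\<bar> \<le> C * \<mu>" for i
    using component_le_norm_cart[of w i] normw by linarith
  \<comment> \<open>The entries of \<open>r\<close> add up to n (1 - \<sigma>) \<mu>, and the factor
    n cancels against the one in \<open>sum_components_le_norm\<close>.\<close>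
  have "real CARD('n) * (95 / 100 * \<mu>) \<le> real CARD('n) * ((1 - \<sigma>) * \<mu>)"
    using sig mup by (intro mult_left_mono mult_right_mono) auto
  also have "\<dots> = (\<Sum>i\<in>UNIV. r $ i)"
    using xs by (simp add: r_def sum_subtractf inner_eq_sum algebra_simps)
  also have "\<dots> \<le> real CARD('n) * norm r"
    by (rule sum_components_le_norm)
  finally have normr: "95 / 100 * \<mu> \<le> norm r"
    by simp
  \<comment> \<open>Together with \<alpha> > 0 this makes the denominator of \<rho> positive, so the
    quotient is not the default value 0 of a division by zero.\<close>
  have normr_pos: "0 < norm r"
    using normr mup by linarith
  have zhat: "zhat = (x + \<alpha> *\<^sub>R dx, y + \<alpha> *\<^sub>R dy, s + \<alpha> *\<^sub>R ds)"
    by (simp add: zhat_def d)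
  have prod: "(x $ i + \<alpha> * dx $ i) * (s $ i + \<alpha> * ds $ i)
      = (1 - \<alpha>) * (x $ i * s $ i) + \<alpha> * (\<sigma> * \<mu>) + \<alpha>\<^sup>2 * w $ i" for i
  proof -
    have "(x $ i + \<alpha> * dx $ i) * (s $ i + \<alpha> * ds $ i)
      = x $ i * s $ i + \<alpha> * (s $ i * dx $ i + x $ i * ds $ i) + \<alpha>\<^sup>2 * w $ i"
      by (simp add: w_def power2_eq_square algebra_simps)
    then show ?thesis
      unfolding eqn by (simp add: algebra_simps)
  qed
  have "A *v (x + \<alpha> *\<^sub>R dx) = b"
    using Ax Adx by (simp add: matrix_vector_right_distrib matrix_vector_mult_scaleR)
  moreover have "transpose A *v (y + \<alpha> *\<^sub>R dy) + (s + \<alpha> *\<^sub>R ds)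
      = (transpose A *v y + s) + \<alpha> *\<^sub>R (transpose A *v dy + ds)"
    by (simp add: matrix_vector_right_distrib matrix_vector_mult_scaleR scaleR_add_right)
  then have "transpose A *v (y + \<alpha> *\<^sub>R dy) + (s + \<alpha> *\<^sub>R ds) = c"
    by (simp only: Ay Ady scaleR_zero_right add_0_right)
  ultimately have "F zhat = (0, 0, \<chi> i. (x + \<alpha> *\<^sub>R dx) $ i * (s + \<alpha> *\<^sub>R ds) $ i - \<sigma> * \<mu>)"
    unfolding F_def zhat by (rule F_map_feasible)
  also have "(\<chi> i. (x + \<alpha> *\<^sub>R dx) $ i * (s + \<alpha> *\<^sub>R ds) $ i - \<sigma> * \<mu>) = (1 - \<alpha>) *\<^sub>R r + \<alpha>\<^sup>2 *\<^sub>R w"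
    by (simp add: vec_eq_iff prod r_def) (simp add: algebra_simps)
  finally have Fhat: "F zhat = (0, 0, (1 - \<alpha>) *\<^sub>R r + \<alpha>\<^sup>2 *\<^sub>R w)" .
  have model: "F (x, y, s) + \<alpha> *\<^sub>R J_map A (x, y, s) d = (0, 0, (1 - \<alpha>) *\<^sub>R r)"
    unfolding J Fz by (simp add: algebra_simps)
  have nm: "norm ((1 - \<alpha>) *\<^sub>R r) = (1 - \<alpha>) * norm r"
    using a by simp
  have rho: "\<rho> = (norm r - norm ((1 - \<alpha>) *\<^sub>R r + \<alpha>\<^sup>2 *\<^sub>R w)) / (\<alpha> * norm r)"
  proof -
    have "norm (F (x, y, s) + \<alpha> *\<^sub>R J_map A (x, y, s) d) = (1 - \<alpha>) * norm r"
      unfolding model nm[symmetric] by (simp only: norm_Pair) simp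
    then have "norm (F (x, y, s)) - norm (F (x, y, s) + \<alpha> *\<^sub>R J_map A (x, y, s) d) = \<alpha> * norm r"
      by (simp add: Fz norm_Pair algebra_simps)
    then show ?thesis
      unfolding \<rho>_def Fhat by (simp add: Fz norm_Pair)
  qed
  \<comment> \<open>The trial residual and its linear model differ only by
    \<open>\<alpha>\<^sup>2 *\<^sub>R w\<close>, so the reverse triangle inequality bounds the
    numerator. One factor \<alpha> cancels, and then \<mu> cancels between the bounds on
    \<open>w\<close> and \<open>r\<close>.\<close>
  then have "1 - \<rho> = (norm ((1 - \<alpha>) *\<^sub>R r + \<alpha>\<^sup>2 *\<^sub>R w) - norm ((1 - \<alpha>) *\<^sub>R r)) / (\<alpha> * norm r)"
    using a(1) normr_pos unfolding nm by (simp add: field_simps)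
  also have "\<bar>\<dots>\<bar> \<le> norm (\<alpha>\<^sup>2 *\<^sub>R w) / (\<alpha> * norm r)"
    using norm_triangle_ineq3[of "(1 - \<alpha>) *\<^sub>R r + \<alpha>\<^sup>2 *\<^sub>R w" "(1 - \<alpha>) *\<^sub>R r"] a(1)
    by (simp add: abs_mult divide_right_mono)
  also have "\<dots> = \<alpha> * norm w / norm r"
    using a(1) normr_pos by (simp add: power2_eq_square)
  also have "\<dots> \<le> \<alpha> * (C * \<mu>) / (95 / 100 * \<mu>)"
    using a(1) normw normr mup C1 by (intro frac_le mult_left_mono mult_nonneg_nonneg) auto
  finally have rho_close: "95 / 100 * \<bar>1 - \<rho>\<bar> \<le> \<alpha> * C"
    using mup by (simp add: field_simps)

  show "t' = 2 * t" if "t \<le> \<gamma> / (8 * C)"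
  proof -
    have aC: "\<alpha> * C \<le> \<gamma> / 8"
      using that a(3) C1 mult_right_mono[of \<alpha> "\<gamma> / (8 * C)" C] by auto
    then have "\<bar>1 - \<rho>\<bar> \<le> 25 / 100"
      using rho_close g by simp
    moreover have "xs_pos zhat"
    proof -
      have "\<alpha> * 1 \<le> \<alpha> * C"
        using a(1) C1 by (intro mult_left_mono) auto
      then have a8: "\<alpha> \<le> 1 / 8"
        using aC g by linarith
      \<comment> \<open>In units of \<gamma> * \<mu>, the retained part of x s is at least 7/8, the
        quadratic term costs at most 1/64, and the centering term is nonnegative.\<close>
      have "(x $ i + \<alpha> * dx $ i) * (s $ i + \<alpha> * ds $ i) > 0" for i
      proof -
        have "\<alpha> * (\<alpha> * C) \<le> 1 / 8 * (\<gamma> / 8)"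
          using a8 aC a(1) g C1 by (intro mult_mono) auto
        then have "\<alpha>\<^sup>2 * C * \<mu> \<le> 1 / 64 * \<gamma> * \<mu>"
          using mup by (intro mult_right_mono) (auto simp: power2_eq_square)
        moreover have "- (\<alpha>\<^sup>2 * (C * \<mu>)) \<le> \<alpha>\<^sup>2 * w $ i"
        proof -
          have "\<alpha>\<^sup>2 * (- (C * \<mu>)) \<le> \<alpha>\<^sup>2 * w $ i"
            using compw[of i] by (intro mult_left_mono) auto
          then show ?thesis
            by simp
        qed
        moreover have "7 / 8 * (\<gamma> * \<mu>) \<le> (1 - \<alpha>) * (x $ i * s $ i)"
          using a8 lb[of i] g mup by - (rule mult_mono, auto)
        moreover have "0 \<le> \<alpha> * (\<sigma> * \<mu>)" "0 < \<gamma> * \<mu>"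
          using a sig mup g by auto
        ultimately show ?thesis
          unfolding prod by (simp add: mult.assoc)
      qed
      then have "x $ i + \<alpha> * dx $ i > 0 \<and> s $ i + \<alpha> * ds $ i > 0" for i
        using xp sp a sig mup eqn by (intro pos_trial_component[where \<nu> = "\<sigma> * \<mu>"]) auto
      then show ?thesis
        by (simp add: zhat xs_pos_def vec_pos_def)
    qed
    ultimately show ?thesis
      using t' by simp
  qed

  show "t / 2 \<le> t'"
    using t' t by (auto split: if_splits)

  show "\<mu>' = \<mu> \<and> t' = t / 2 \<or> \<mu>' \<le> (1 - 95 / 100 * (t / (1 + t))) * \<mu>"
  proof (cases "\<rho> \<ge> 1 / 10 ^ 6 \<and> xs_pos zhat")
    case True
    then have x': "x' = x + \<alpha> *\<^sub>R dx" and s': "s' = s + \<alpha> *\<^sub>R ds"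
      using z' zhat by auto
    have "x' \<bullet> s' = (\<Sum>i\<in>UNIV. (1 - \<alpha>) * (x $ i * s $ i) + \<alpha> * (\<sigma> * \<mu>) + \<alpha>\<^sup>2 * (dx $ i * ds $ i))"
      by (simp add: inner_eq_sum x' s' prod w_def)
    also have "\<dots> = (1 - \<alpha>) * (x \<bullet> s) + real CARD('n) * (\<alpha> * (\<sigma> * \<mu>)) + \<alpha>\<^sup>2 * (dx \<bullet> ds)"
      by (simp add: sum.distrib inner_eq_sum sum_distrib_left)
    finally have "\<mu>' = (1 - \<alpha> * (1 - \<sigma>)) * \<mu>"
      unfolding \<mu>'_def xs orth by (simp add: field_simps)
    also have "\<dots> \<le> (1 - \<alpha> * (95 / 100)) * \<mu>"
      using sig a mup by (intro mult_right_mono diff_left_mono mult_left_mono) auto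
    finally show ?thesis
      by (simp add: \<alpha>_def mult.commute)
  next
    case False
    \<comment> \<open>A rejection always reaches the last branch: \<rho> < 1 / 10 ^ 6 makes the
      distance from 1 to \<rho> exceed 3/4, and a failure of positivity excludes both other
      branches.\<close>
    then have "t' = t / 2"
      using t' by auto
    then show ?thesis
      using False z' by (auto simp: \<mu>'_def \<mu>_def)
  qed
qed

section \<open>Convergence of the duality measure\<close>

theorem theorem3p1:
  fixes A :: "real^'n^'m" and b :: "real^'m" and c :: "real^'n" and \<gamma> :: real
    and x0 s0 :: "real^'n" and y0 :: "real^'m"
    and x s :: "nat \<Rightarrow> real^'n" and y :: "nat \<Rightarrow> real^'m"
  assumes full_row_rank: "rank A = CARD('m)"
    and gamma: "0 < \<gamma>" "\<gamma> < 1"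
    and start: "(x0, y0, s0) \<in> strictly_feasible A b c"
    and iteration: "pfmtrlp_sequence A b c (x0, y0, s0) (\<lambda>k. (x k, y k, s k))"
    and nbhd: "\<And>k. (x k, y k, s k) \<in> one_sided_nbhd A b c \<gamma>"
  shows "(\<lambda>k. (x k \<bullet> s k) / real CARD('n)) \<longlonglongrightarrow> 0"
proof -
  obtain t d where t0: "t 0 = 9 / 10"
    and step: "\<And>k. pfmtrlp_step A b c (x k, y k, s k) (t k) (d k)
      (x (Suc k), y (Suc k), s (Suc k)) (t (Suc k))"
    using iteration unfolding pfmtrlp_sequence_def by auto
  define \<mu> where "\<mu> k = (x k \<bullet> s k) / real CARD('n)" for k
  define \<beta> where "\<beta> = \<gamma> / (8 * (real CARD('n) * (1 + 1 / \<gamma>) / 2))"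
  note one_step = pfmtrlp_step_nbhd[OF gamma _ nbhd step, folded \<mu>_def \<beta>_def]
  have b0: "0 < \<beta>"
    using gamma by (simp add: \<beta>_def add_pos_pos)
  \<comment> \<open>Serves the base case of \<open>tlow\<close>, where \<beta> / 2 must not exceed
    the initial step 9/10.\<close>
  have b1: "\<beta> \<le> 1"
  proof -
    have "1 * 2 \<le> real CARD('n) * (1 + 1 / \<gamma>)"
      using gamma by (intro mult_mono) (auto simp: Suc_le_eq)
    then show ?thesis
      using gamma by (simp add: \<beta>_def divide_le_eq_1)
  qed
  \<comment> \<open>Up to \<beta> the time step is doubled, so a halving starts above \<beta> and
    cannot end below \<beta> / 2.\<close>
  have tlow: "\<beta> / 2 \<le> t k" for k
  proof (induction k)
    case 0
    then show ?case
      using b1 t0 by simp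
  next
    case (Suc k)
    then have "0 < t k"
      using b0 by linarith
    from one_step(1,2)[OF this] show ?case
      using Suc b0 by (cases "t k \<le> \<beta>") auto
  qed
  then have tpos: "0 < t k" for k
    using b0 by (metis half_gt_zero less_le_trans)
  have mupos: "0 \<le> \<mu> k" for k
  proof -
    have "0 < x k $ i" "0 < s k $ i" for i
      using nbhd[of k] by (auto simp: one_sided_nbhd_def strictly_feasible_def vec_pos_def)
    then have "0 \<le> x k \<bullet> s k"
      unfolding inner_eq_sum by (intro sum_nonneg mult_nonneg_nonneg less_imp_le)
    then show ?thesis
      by (simp add: \<mu>_def)
  qed
  \<comment> \<open>Since t / (1 + t) increases with t, its value at the lower bound \<beta> / 2
    gives one contraction factor for all accepted steps.\<close>
  define q where "q = 1 - 95 / 100 * (\<beta> / 2 / (1 + \<beta> / 2))"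
  have q: "0 < q" "q < 1"
    using b0 by (auto simp: q_def field_simps)
  have dec: "\<mu> (Suc k) = \<mu> k \<and> t (Suc k) = t k / 2 \<or> \<mu> (Suc k) \<le> q * \<mu> k" for k
  proof -
    have "\<beta> / 2 / (1 + \<beta> / 2) \<le> t k / (1 + t k)"
      using tlow[of k] tpos[of k] b0 by (simp add: field_simps)
    then have "1 - 95 / 100 * (t k / (1 + t k)) \<le> q"
      unfolding q_def by linarith
    then have "(1 - 95 / 100 * (t k / (1 + t k))) * \<mu> k \<le> q * \<mu> k"
      using mupos by (rule mult_right_mono)
    then show ?thesis
      using one_step(3)[OF tpos, of k] by linarith
  qed
  have "\<mu> (Suc k) \<le> \<mu> k" for k
    using dec[of k] mult_right_mono[of q 1 "\<mu> k"] q mupos[of k] by auto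
  then have "decseq \<mu>"
    by (simp add: decseq_Suc_iff)
  then obtain L where L: "\<mu> \<longlonglongrightarrow> L" and Lle: "\<And>k. L \<le> \<mu> k"
    using decseq_convergent[of \<mu> 0] mupos by blast
  have accepted: "\<exists>k\<ge>N. \<mu> (Suc k) \<le> q * \<mu> k" for N
  proof (rule ccontr)
    assume "\<not> ?thesis"
    then have half: "t (Suc k) = t k / 2" if "k \<ge> N" for k
      using dec that by blast
    have "t (N + j) = t N / 2 ^ j" for j
      by (induction j) (simp_all add: half)
    then have "(\<lambda>j. t (j + N)) = (\<lambda>j. t N * (1 / 2) ^ j)"
      by (intro ext) (metis add.commute mult.right_neutral power_one_over times_divide_eq_right)
    moreover have "(\<lambda>j. t N * (1 / 2) ^ j) \<longlonglongrightarrow> 0"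
      by (intro tendsto_mult_right_zero LIMSEQ_realpow_zero) auto
    ultimately have "(\<lambda>j. t (j + N)) \<longlonglongrightarrow> 0"
      by simp
    then have "\<beta> / 2 \<le> 0"
      by (rule LIMSEQ_le_const) (use tlow in auto)
    then show False
      using b0 by simp
  qed
  have "L \<le> 0"
  proof (rule ccontr)
    assume "\<not> L \<le> 0"
    \<comment> \<open>Eventually \<mu> is below L / q, and a single contraction from there would
      push it below L, which bounds the sequence from below.\<close>
    then have "L < L / q"
      using q by (simp add: field_simps)
    then obtain N where N: "\<And>k. k \<ge> N \<Longrightarrow> \<mu> k < L / q"
      using order_tendstoD(2)[OF L] unfolding eventually_sequentially by blast
    obtain k where "k \<ge> N" "\<mu> (Suc k) \<le> q * \<mu> k"
      using accepted by blast
    then show False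
      using N[of k] Lle[of "Suc k"] q by (simp add: field_simps)
  qed
  moreover have "0 \<le> L"
    using LIMSEQ_le_const[OF L] mupos by blast
  ultimately show ?thesis
    using L unfolding \<mu>_def by simp
qed

end
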